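(* Let $X\in\mathbb{R}^{n\times p}$ be a matrix no two columns of which are identical, and let $\gamma>1$. Define $$S=\frac1n\sum_{i=1}^n X_{i,:}^\top X_{i,:},\qquad \hat R=\mathbf{1}\,\mathrm{diag}(S)^\top+\mathrm{diag}(S)\mathbf{1}^\top-2S,\qquad \bar R=\big(\mathrm{MDS}_+(\hat R^{\circ\gamma})\big)^{\circ\frac1\gamma},$$ $$\bar L=\Big(-\tfrac12 J\bar RJ+\tfrac1p\mathbf{1}\mathbf{1}^\top\Big)^{-1}-\tfrac1p\mathbf{1}\mathbf{1}^\top .$$ Then $\bar L$ (the inverse in its definition exists) is a signed positive semidefinite Laplacian with rank $p-1$. Thus the last step is equivalent to taking the pseudoinverse, i.e. $\bar L=\big(-\tfrac12 J\bar RJ\big)^\dagger$.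
   Context: $X_{i,:}$ is the $i$-th row of $X$ (a row vector), $\mathbf{1}\in\mathbb{R}^p$ is the all-ones column vector, $J=I-\frac1p\mathbf{1}\mathbf{1}^\top$ is the $p\times p$ centering matrix, $\mathrm{diag}(M)$ is the column vector of diagonal entries of $M$, and $M^\dagger$ is the Moore–Penrose pseudoinverse. For a matrix $D$ with nonnegative entries and $\alpha>0$, the elementwise power $D^{\circ\alpha}$ is the matrix with entries $[D^{\circ\alpha}]_{ij}=D_{ij}^\alpha$. The map $\mathrm{MDS}_+$ takes a symmetric $p\times p$ matrix $Y$ with zero diagonal to the matrix $D=\mathrm{MDS}_+(Y)$ computed as follows: let $B=-\frac12JYJ$, with eigendecomposition $B=Q\Lambda Q^\top$ ($Q$ orthogonal, $\Lambda$ diagonal); let $\Lambda_+$ be $\Lambda$ with negative eigenvalues replaced by zero; let $G=Q\Lambda_+Q^\top$; and set $D=\mathbf{1}\,\mathrm{diag}(G)^\top+\mathrm{diag}(G)\mathbf{1}^\top-2G$. A signed Laplacian is the Laplacian of an undirected graph whose edge weights may be negative, i.e. a real symmetric $p\times p$ matrix $L$ with $L\mathbf{1}=0$ (edge weights being $-L_{ij}$ for $i\ne j$). *)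

theory Defs
  imports "HOL-Analysis.Analysis"
begin

text \<open>
  Throughout, \<open>1 :: real ^ 'p\<close> is the all-ones vector, whereas the identity matrix is \<open>mat 1\<close>.
\<close>

definition outer :: "real ^ 'm \<Rightarrow> real ^ 'n \<Rightarrow> real ^ 'n ^ 'm" where
  "outer u v = (\<chi> i j. u $ i * v $ j)"

definition centering :: "real ^ 'p ^ 'p" where
  "centering = mat 1 - (1 / real CARD('p)) *\<^sub>R outer 1 1"

definition diag_vec :: "real ^ 'p ^ 'p \<Rightarrow> real ^ 'p" where
  "diag_vec M = (\<chi> i. M $ i $ i)"

definition diag_mat :: "real ^ 'p \<Rightarrow> real ^ 'p ^ 'p" where
  "diag_mat d = (\<chi> i j. if i = j then d $ i else 0)"

text \<open>Elementwise power; only meant for matrices with nonnegative entries. Note \<open>0 powr a = 0\<close>.\<close>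

definition hadamard_power :: "real ^ 'm ^ 'n \<Rightarrow> real \<Rightarrow> real ^ 'm ^ 'n" where
  "hadamard_power D a = (\<chi> i j. (D $ i $ j) powr a)"

definition gram_to_sqdist :: "real ^ 'p ^ 'p \<Rightarrow> real ^ 'p ^ 'p" where
  "gram_to_sqdist G = outer 1 (diag_vec G) + outer (diag_vec G) 1 - 2 *\<^sub>R G"

definition eigendecomposition :: "real ^ 'p ^ 'p \<Rightarrow> real ^ 'p ^ 'p \<Rightarrow> real ^ 'p \<Rightarrow> bool" where
  "eigendecomposition B Q l \<longleftrightarrow>
     orthogonal_matrix Q \<and> B = Q ** diag_mat l ** transpose Q"

definition is_MDS_plus :: "real ^ 'p ^ 'p \<Rightarrow> real ^ 'p ^ 'p \<Rightarrow> bool" where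
  "is_MDS_plus Y D \<longleftrightarrow>
     (\<exists>Q l. eigendecomposition (- (1 / 2) *\<^sub>R (centering ** Y ** centering)) Q l \<and>
            D = gram_to_sqdist (Q ** diag_mat (\<chi> i. max 0 (l $ i)) ** transpose Q))"

definition MDS_plus :: "real ^ 'p ^ 'p \<Rightarrow> real ^ 'p ^ 'p" where
  "MDS_plus Y = (THE D. is_MDS_plus Y D)"

text \<open>
  The result does not depend on the chosen eigendecomposition; a result exists for every
  symmetric \<open>Y\<close> by the spectral theorem.
\<close>

lemma diag_mat_mult_left: "(diag_mat l ** M) $ i $ j = l $ i * M $ i $ j"
  by (simp add: diag_mat_def matrix_matrix_mult_def if_distrib [of "\<lambda>x. x * _"] cong: if_cong)

lemma diag_mat_mult_right: "(M ** diag_mat l) $ i $ j = M $ i $ j * l $ j"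
  by (simp add: diag_mat_def matrix_matrix_mult_def if_distrib [of "\<lambda>x. _ * x"] cong: if_cong)

lemma is_MDS_plus_unique:
  assumes "is_MDS_plus Y D" "is_MDS_plus Y E"
  shows "D = E"
proof -
  let ?pos = "\<lambda>l :: real ^ 'a. diag_mat (\<chi> i. max 0 (l $ i))"
  have "P ** ?pos k ** transpose P = Q ** ?pos l ** transpose Q"
    if P: "eigendecomposition B P k" and Q: "eigendecomposition B Q l" for B P Q k l
  proof -
    have oP: "transpose P ** P = mat 1" "P ** transpose P = mat 1"
      and oQ: "transpose Q ** Q = mat 1" "Q ** transpose Q = mat 1"
      using P Q by (auto simp: eigendecomposition_def orthogonal_matrix_def)
    define M where "M = transpose P ** Q"
    have eq: "P ** diag_mat k ** transpose P = Q ** diag_mat l ** transpose Q"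
      using P Q by (simp add: eigendecomposition_def)
    have "diag_mat k ** M = transpose P ** (P ** diag_mat k ** transpose P) ** Q"
      by (metis M_def matrix_mul_assoc matrix_mul_lid oP(1))
    also have "\<dots> = M ** diag_mat l"
      unfolding eq by (metis M_def matrix_mul_assoc matrix_mul_rid oQ(1))
    finally have *: "k $ i * M $ i $ j = M $ i $ j * l $ j" for i j
      by (metis diag_mat_mult_left diag_mat_mult_right)
    have "?pos k ** M = M ** ?pos l"
    proof -
      have "max 0 (k $ i) * M $ i $ j = M $ i $ j * max 0 (l $ j)" for i j
        using * [of i j] by (cases "M $ i $ j = 0") auto
      then show ?thesis
        by (simp add: vec_eq_iff diag_mat_mult_left diag_mat_mult_right)
    qed
    then have "P ** (?pos k ** M) ** transpose Q = P ** (M ** ?pos l) ** transpose Q"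
      by simp
    then show ?thesis
      by (metis M_def matrix_mul_assoc matrix_mul_lid matrix_mul_rid oP(2) oQ(2))
  qed
  then show ?thesis
    using assms unfolding is_MDS_plus_def by metis
qed

definition signed_laplacian :: "real ^ 'p ^ 'p \<Rightarrow> bool" where
  "signed_laplacian L \<longleftrightarrow> transpose L = L \<and> L *v 1 = 0"

definition positive_semidefinite :: "real ^ 'p ^ 'p \<Rightarrow> bool" where
  "positive_semidefinite A \<longleftrightarrow> transpose A = A \<and> (\<forall>x. 0 \<le> x \<bullet> (A *v x))"

text \<open>The four Penrose equations.\<close>

definition is_pseudoinverse :: "real ^ 'n ^ 'm \<Rightarrow> real ^ 'm ^ 'n \<Rightarrow> bool" where
  "is_pseudoinverse A P \<longleftrightarrow>
     A ** P ** A = A \<and> P ** A ** P = P \<and>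
     transpose (A ** P) = A ** P \<and> transpose (P ** A) = P ** A"

definition pseudoinverse :: "real ^ 'n ^ 'm \<Rightarrow> real ^ 'm ^ 'n" where
  "pseudoinverse A = (THE P. is_pseudoinverse A P)"

lemma is_pseudoinverse_unique:
  assumes P: "is_pseudoinverse A P" and Q: "is_pseudoinverse A Q"
  shows "P = Q"
proof -
  have "A ** P = transpose (A ** Q ** (A ** P))"
    using P Q by (metis is_pseudoinverse_def matrix_mul_assoc)
  also have "\<dots> = A ** P ** (A ** Q)"
    using P Q by (metis is_pseudoinverse_def matrix_transpose_mul)
  also have "\<dots> = A ** Q"
    using P by (metis is_pseudoinverse_def matrix_mul_assoc)
  finally have 1: "A ** P = A ** Q" .
  have "P ** A = transpose (P ** A ** (Q ** A))"
    using P Q by (metis is_pseudoinverse_def matrix_mul_assoc)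
  also have "\<dots> = Q ** A ** (P ** A)"
    using P Q by (metis is_pseudoinverse_def matrix_transpose_mul)
  also have "\<dots> = Q ** A"
    using P by (metis is_pseudoinverse_def matrix_mul_assoc)
  finally have 2: "P ** A = Q ** A" .
  show ?thesis
    using P Q 1 2 by (metis is_pseudoinverse_def matrix_mul_assoc)
qed

end

theory Submission
  imports Defs
begin

text \<open>
  Clipping the negative eigenvalues adds the squared distance matrix of the discarded part, so
  the output of \<open>MDS_plus\<close> is a squared Euclidean distance matrix dominating its input entrywise;
  hence it comes from pairwise distinct points. By a strict form of Schoenberg's theorem, the
  power \<open>0 < 1 / \<gamma> < 1\<close> of such a matrix is negative definite on the orthogonal complement of
  the all-ones vector: \<open>t powr a\<close> is a positive multiple of
  \<open>\<integral> (1 - exp (- t s)) s powr (- a - 1) ds\<close> over \<open>s > 0\<close>, Gaussian kernels are positive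
  semidefinite, and for distinct points they tend to the identity as \<open>s\<close> grows.
  Thus \<open>- 1/2 J R J\<close> is positive semidefinite with kernel spanned by the all-ones vector,
  and adding the projection onto that vector makes it invertible.
\<close>

section \<open>Powers of squared distances\<close>

text \<open>A case of the Schur product theorem. Expanding one factor of the inner product over
  \<open>Basis\<close> turns the form for \<open>Suc n\<close> into a sum of forms for
  \<open>n\<close> whose coefficients have absorbed the coordinate \<open>x i \<bullet> b\<close>;
  hence the induction is for arbitrary \<open>c\<close>.\<close>

lemma psd_inner_power:
  fixes x :: "'i \<Rightarrow> 'a::euclidean_space" and c :: "'i \<Rightarrow> real"
  shows "0 \<le> (\<Sum>i\<in>I. \<Sum>j\<in>I. c i * c j * (x i \<bullet> x j) ^ n)"
proof (induction n arbitrary: c)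
  case 0
  have "(\<Sum>i\<in>I. \<Sum>j\<in>I. c i * c j * (x i \<bullet> x j) ^ 0) = (\<Sum>i\<in>I. c i) ^ 2"
    by (simp add: power2_eq_square sum_product)
  then show ?case by simp
next
  case (Suc n)
  have "(\<Sum>i\<in>I. \<Sum>j\<in>I. c i * c j * (x i \<bullet> x j) ^ Suc n)
      = (\<Sum>i\<in>I. \<Sum>j\<in>I. \<Sum>b\<in>Basis. (c i * (x i \<bullet> b)) * (c j * (x j \<bullet> b)) * (x i \<bullet> x j) ^ n)"
  proof (intro sum.cong refl)
    fix i j
    define p where "p = (x i \<bullet> x j) ^ n"
    have "c i * c j * (x i \<bullet> x j) ^ Suc n = (x i \<bullet> x j) * (c i * c j * p)"
      by (simp add: p_def)
    also have "\<dots> = (\<Sum>b\<in>Basis. (c i * (x i \<bullet> b)) * (c j * (x j \<bullet> b)) * p)"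
      unfolding euclidean_inner [of "x i" "x j"] by (simp add: sum_distrib_left sum_distrib_right mult_ac)
    finally show "c i * c j * (x i \<bullet> x j) ^ Suc n
        = (\<Sum>b\<in>Basis. (c i * (x i \<bullet> b)) * (c j * (x j \<bullet> b)) * (x i \<bullet> x j) ^ n)"
      by (simp only: p_def)
  qed
  also have "\<dots> = (\<Sum>b\<in>Basis. \<Sum>i\<in>I. \<Sum>j\<in>I. (c i * (x i \<bullet> b)) * (c j * (x j \<bullet> b)) * (x i \<bullet> x j) ^ n)"
    by (simp add: sum.swap [of _ Basis])
  also have "\<dots> \<ge> 0"
    by (intro sum_nonneg Suc.IH)
  finally show ?case .
qed

text \<open>The exponential series has nonnegative coefficients, so the form is a sum of nonnegative
  multiples of the forms for powers of the Gram matrix.\<close>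

lemma psd_exp_inner:
  fixes x :: "'i \<Rightarrow> 'a::euclidean_space" and c :: "'i \<Rightarrow> real"
  assumes "0 \<le> t"
  shows "0 \<le> (\<Sum>i\<in>I. \<Sum>j\<in>I. c i * c j * exp (t * (x i \<bullet> x j)))"
proof -
  have "(\<lambda>n. c i * c j * ((t * (x i \<bullet> x j)) ^ n /\<^sub>R fact n)) sums (c i * c j * exp (t * (x i \<bullet> x j)))"
    for i j
    by (intro sums_mult exp_converges)
  then have sums: "(\<lambda>n. \<Sum>i\<in>I. \<Sum>j\<in>I. c i * c j * ((t * (x i \<bullet> x j)) ^ n /\<^sub>R fact n)) sums
      (\<Sum>i\<in>I. \<Sum>j\<in>I. c i * c j * exp (t * (x i \<bullet> x j)))"
    by (intro sums_sum)
  have nonneg: "0 \<le> (\<Sum>i\<in>I. \<Sum>j\<in>I. c i * c j * ((t * (x i \<bullet> x j)) ^ n /\<^sub>R fact n))" for n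
  proof -
    have "(\<Sum>i\<in>I. \<Sum>j\<in>I. c i * c j * ((t * (x i \<bullet> x j)) ^ n /\<^sub>R fact n))
        = t ^ n / fact n * (\<Sum>i\<in>I. \<Sum>j\<in>I. c i * c j * (x i \<bullet> x j) ^ n)"
      unfolding sum_distrib_left by (intro sum.cong refl) (simp add: power_mult_distrib field_simps)
    also have "\<dots> \<ge> 0"
      using assms by (intro mult_nonneg_nonneg psd_inner_power) auto
    finally show ?thesis .
  qed
  show ?thesis
    by (rule sums_le [OF nonneg sums_zero sums])
qed

lemma psd_gaussian:
  fixes x :: "'i \<Rightarrow> 'a::euclidean_space" and c :: "'i \<Rightarrow> real"
  assumes "0 \<le> s"
  shows "0 \<le> (\<Sum>i\<in>I. \<Sum>j\<in>I. c i * c j * exp (- ((dist (x i) (x j))\<^sup>2 * s)))"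
proof -
  \<comment> \<open>Expanding the squared distance leaves a mixed term
    \<open>2 * s * (x i \<bullet> x j)\<close>; the factors depending on one index only are absorbed
    into the coefficients.\<close>
  define d where "d i = c i * exp (- (s * (x i \<bullet> x i)))" for i
  have "c i * c j * exp (- ((dist (x i) (x j))\<^sup>2 * s)) = d i * d j * exp ((2 * s) * (x i \<bullet> x j))" for i j
  proof -
    have "- ((dist (x i) (x j))\<^sup>2 * s) = - (s * (x i \<bullet> x i)) + - (s * (x j \<bullet> x j)) + (2 * s) * (x i \<bullet> x j)"
      by (simp add: dist_norm power2_norm_eq_inner inner_diff inner_commute algebra_simps)
    then show ?thesis
      by (simp only: exp_add d_def mult_ac)
  qed
  then show ?thesis
    using assms psd_exp_inner [of "2 * s" d x I] by simp
qed

section \<open>Integral representation of real powers\<close>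

text \<open>The integrand of the representation of \<open>t powr a\<close>, cut off by an indicator
  so that it can be integrated over the whole line and rescaled there.\<close>

definition powr_kernel :: "real \<Rightarrow> real \<Rightarrow> real \<Rightarrow> real" where
  "powr_kernel a t s = indicator {0<..} s * ((1 - exp (- (t * s))) * s powr (- a - 1))"

lemma powr_kernel_scale:
  assumes "0 < t"
  shows "powr_kernel a t s = t powr (a + 1) * powr_kernel a 1 (t * s)"
proof -
  have "t powr (a + 1) * (t * s) powr (- a - 1) = s powr (- a - 1)" if "0 < s"
  proof -
    have "t powr (a + 1) * t powr (- a - 1) = 1"
      using assms by (simp flip: powr_add)
    then show ?thesis
      using assms that by (simp add: powr_mult)
  qed
  then show ?thesis
    using assms by (auto simp: powr_kernel_def indicator_def zero_less_mult_iff)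
qed

lemma integrable_powr_kernel_1:
  assumes "0 < a" "a < 1"
  shows "integrable lborel (powr_kernel a 1)"
proof (rule Bochner_Integration.integrable_bound)
  \<comment> \<open>Near 0 the bound \<open>1 - exp (- s) \<le> s\<close> leaves
    \<open>s powr (- a)\<close>, integrable since \<open>a < 1\<close>; near infinity the bound by 1
    leaves \<open>s powr (- a - 1)\<close>, integrable since \<open>0 < a\<close>.\<close>
  let ?g = "\<lambda>s. indicator {0..1} s *\<^sub>R (s powr (- a)) + indicator {1..} s *\<^sub>R (s powr (- a - 1)) :: real"
  have "(\<lambda>s. s powr (- a)) absolutely_integrable_on {0..1}"
    using assms by (subst absolutely_integrable_on_iff_nonneg) (auto intro!: integrable_on_powr_from_0)
  moreover have "(\<lambda>s. s powr (- a - 1)) absolutely_integrable_on {1..}"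
    using assms has_integral_powr_to_inf [of "- a - 1" 1]
    by (subst absolutely_integrable_on_iff_nonneg) (auto simp: integrable_on_def)
  ultimately have "integrable lebesgue (\<lambda>s. indicator {0..1::real} s *\<^sub>R (s powr (- a)))"
    "integrable lebesgue (\<lambda>s. indicator {1..} s *\<^sub>R (s powr (- a - 1)))"
    by (simp_all only: set_integrable_def)
  \<comment> \<open>Both functions are Borel measurable, so integrability passes from the completed
    measure to \<open>lborel\<close>.\<close>
  then have "integrable lborel (\<lambda>s. indicator {0..1::real} s *\<^sub>R (s powr (- a)))"
    "integrable lborel (\<lambda>s. indicator {1..} s *\<^sub>R (s powr (- a - 1)))"
    by (simp_all add: integrable_completion)
  then show "integrable lborel ?g"
    by (intro Bochner_Integration.integrable_add)
  show "powr_kernel a 1 \<in> borel_measurable lborel"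
    unfolding powr_kernel_def by measurable
  show "AE s in lborel. norm (powr_kernel a 1 s) \<le> norm (?g s)"
  proof (intro AE_I2)
    fix s :: real
    have "norm (powr_kernel a 1 s) \<le> ?g s"
    proof (cases "0 < s")
      case s: True
      have e: "0 \<le> 1 - exp (- s)" "1 - exp (- s) \<le> s" "1 - exp (- s) \<le> 1"
        using s exp_ge_add_one_self [of "- s"] by auto
      have *: "norm (powr_kernel a 1 s) = (1 - exp (- s)) * s powr (- a - 1)"
        using s e by (simp add: powr_kernel_def)
      have "(1 - exp (- s)) * s powr (- a - 1) \<le> s * s powr (- a - 1)"
        using e by (intro mult_right_mono) auto
      also have "\<dots> = s powr (- a)"
        using s powr_add [of s 1 "- a - 1"] by simp
      finally have "(1 - exp (- s)) * s powr (- a - 1) \<le> s powr (- a)" .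
      moreover have "(1 - exp (- s)) * s powr (- a - 1) \<le> 1 * s powr (- a - 1)"
        using e by (intro mult_right_mono) auto
      moreover have "s powr (- a) \<le> ?g s" if "s \<le> 1"
        using s that by (simp add: indicator_def)
      moreover have "1 * s powr (- a - 1) \<le> ?g s" if "1 \<le> s"
        using s that by (simp add: indicator_def)
      ultimately show ?thesis
        unfolding * by linarith
    qed (auto simp: powr_kernel_def)
    then show "norm (powr_kernel a 1 s) \<le> norm (?g s)"
      by simp
  qed
qed

text \<open>Substituting \<open>t * s\<close> for the variable reduces to \<open>t = 1\<close>:
  scaling contributes \<open>t powr (a + 1)\<close> and the Jacobian removes one factor
  \<open>t\<close>. For \<open>t = 0\<close> the kernel vanishes, in agreement with
  \<open>0 powr a = 0\<close>.\<close>

lemma powr_kernel_integral: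
  assumes "0 < a" "a < 1" "0 \<le> t"
  shows integrable_powr_kernel: "integrable lborel (powr_kernel a t)"
    and integral_powr_kernel: "(LBINT s. powr_kernel a t s) = t powr a * (LBINT s. powr_kernel a 1 s)"
proof -
  have "integrable lborel (powr_kernel a t) \<and>
    (LBINT s. powr_kernel a t s) = t powr a * (LBINT s. powr_kernel a 1 s)"
  proof (cases "t = 0")
    case True
    then have "powr_kernel a t = (\<lambda>_. 0)"
      by (simp add: powr_kernel_def fun_eq_iff)
    with True show ?thesis by simp
  next
    case False
    with assms have t: "0 < t" by simp
    note scale = powr_kernel_scale [OF t, of a, abs_def]
    have "integrable lborel (\<lambda>s. powr_kernel a 1 (0 + t * s))"
      using t by (intro lborel_integrable_real_affine integrable_powr_kernel_1 assms) simp
    then have 1: "integrable lborel (powr_kernel a t)"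
      unfolding scale by simp
    have "(LBINT s. powr_kernel a 1 s) = t * (LBINT s. powr_kernel a 1 (t * s))"
      using lborel_integral_real_affine [of t "powr_kernel a 1" 0] t by simp
    moreover have "t powr (a + 1) = t powr a * t"
      using t by (simp add: powr_add)
    ultimately have "(LBINT s. powr_kernel a t s) = t powr a * (LBINT s. powr_kernel a 1 s)"
      unfolding scale by simp
    with 1 show ?thesis by blast
  qed
  then show "integrable lborel (powr_kernel a t)"
    "(LBINT s. powr_kernel a t s) = t powr a * (LBINT s. powr_kernel a 1 s)" by auto
qed

text \<open>Up to the factor \<open>- K\<close>, the form is the integral of \<open>F\<close>, a
  weighted Gaussian form. This is nonnegative everywhere and positive for large \<open>s\<close>,
  where only the diagonal terms survive.\<close>

lemma sqdist_powr_conditionally_negative: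
  fixes x :: "'i \<Rightarrow> 'a::euclidean_space" and c :: "'i \<Rightarrow> real"
  assumes I: "finite I" and inj: "inj_on x I" and a: "0 < a" "a < 1"
    and sum0: "sum c I = 0" and nz: "\<exists>i\<in>I. c i \<noteq> 0"
  shows "(\<Sum>i\<in>I. \<Sum>j\<in>I. c i * c j * ((dist (x i) (x j))\<^sup>2) powr a) < 0"
proof -
  define D where "D i j = (dist (x i) (x j))\<^sup>2" for i j
  define K where "K = (LBINT s. powr_kernel a 1 s)"
  define \<Phi> where "\<Phi> s = (\<Sum>i\<in>I. \<Sum>j\<in>I. c i * c j * exp (- (D i j * s)))" for s
  define F where "F s = indicator {0<..} s * (\<Phi> s * s powr (- a - 1))" for s :: real
  have F_eq: "F s = - (\<Sum>i\<in>I. \<Sum>j\<in>I. c i * c j * powr_kernel a (D i j) s)" for s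
  proof -
    define w where "w = indicator {0<..} s * s powr (- a - 1)"
    have "(\<Sum>i\<in>I. \<Sum>j\<in>I. c i * c j * powr_kernel a (D i j) s)
        = (\<Sum>i\<in>I. \<Sum>j\<in>I. (c i * c j) * w) - (\<Sum>i\<in>I. \<Sum>j\<in>I. (c i * c j * exp (- (D i j * s))) * w)"
      unfolding sum_subtractf [symmetric]
      by (intro sum.cong refl) (simp add: powr_kernel_def w_def algebra_simps)
    \<comment> \<open>The constant 1 in \<open>1 - exp (- (t * s))\<close> contributes the square of
      \<open>sum c I\<close>, which is zero.\<close>
    also have "\<dots> = (sum c I * sum c I) * w - \<Phi> s * w"
      by (simp add: \<Phi>_def sum_product flip: sum_distrib_right)
    finally show ?thesis
      by (simp add: sum0 F_def w_def)
  qed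
  have int: "integrable lborel (powr_kernel a (D i j))" for i j
    using a by (intro integrable_powr_kernel) (auto simp: D_def)
  have intD: "(LBINT s. powr_kernel a (D i j) s) = D i j powr a * K" for i j
    unfolding K_def using a by (intro integral_powr_kernel) (auto simp: D_def)
  have intF: "integrable lborel F"
    unfolding F_eq [abs_def] using int by simp
  have "(LBINT s. F s) = - (\<Sum>i\<in>I. \<Sum>j\<in>I. c i * c j * (D i j powr a * K))"
    unfolding F_eq using int by (simp add: intD)
  also have "\<dots> = - (\<Sum>i\<in>I. \<Sum>j\<in>I. c i * c j * D i j powr a) * K"
    by (simp add: sum_distrib_left sum_distrib_right mult_ac)
  finally have LF: "(LBINT s. F s) = - (\<Sum>i\<in>I. \<Sum>j\<in>I. c i * c j * D i j powr a) * K" .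
  have \<Phi>0: "0 \<le> \<Phi> s" if "0 \<le> s" for s
    unfolding \<Phi>_def D_def using psd_gaussian [OF that] .
  have F0: "0 \<le> F s" for s
    using \<Phi>0 by (auto simp: F_def indicator_def)
  have "(\<Phi> \<longlongrightarrow> (\<Sum>i\<in>I. \<Sum>j\<in>I. c i * c j * (if i = j then 1 else 0))) at_top"
    unfolding \<Phi>_def
  proof (intro tendsto_sum tendsto_mult tendsto_const)
    fix i j assume ij: "i \<in> I" "j \<in> I"
    show "((\<lambda>s. exp (- (D i j * s))) \<longlongrightarrow> (if i = j then 1 else 0)) at_top"
    proof (cases "i = j")
      case False
      then have "0 < D i j"
        using ij inj by (simp add: D_def inj_on_eq_iff)
      then have "filterlim (\<lambda>s. - (D i j * s)) at_bot at_top"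
        unfolding filterlim_uminus_at_top [symmetric] filterlim_uminus_at_bot minus_minus
        by (intro filterlim_tendsto_pos_mult_at_top [OF tendsto_const] filterlim_ident)
      then show ?thesis
        using False filterlim_compose [OF exp_at_bot] by simp
    qed (simp add: D_def)
  qed
  moreover have "(\<Sum>i\<in>I. \<Sum>j\<in>I. c i * c j * (if i = j then 1 else 0)) = (\<Sum>i\<in>I. (c i)\<^sup>2)"
    using I by (simp add: if_distrib power2_eq_square cong: if_cong)
  moreover have "(\<Sum>i\<in>I. (c i)\<^sup>2) > 0"
    using nz I by (metis sum_pos2 zero_le_power2 zero_less_power2)
  ultimately have "eventually (\<lambda>s. \<Phi> s > 0) at_top"
    by (metis order_tendstoD(1))
  then obtain N where N: "\<And>s. s \<ge> N \<Longrightarrow> \<Phi> s > 0"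
    unfolding eventually_at_top_linorder by blast
  have "(LBINT s. F s) \<noteq> 0"
  proof
    assume "(LBINT s. F s) = 0"
    then have "AE s in lborel. F s = 0"
      using integral_nonneg_eq_0_iff_AE [OF intF] F0 by simp
    \<comment> \<open>On this interval of length one \<open>F\<close> is positive: \<open>N\<close>
      makes \<open>\<Phi>\<close> positive, and the bound 1 keeps \<open>s\<close>, and with it the
      weight, positive.\<close>
    then have "AE s in lborel. s \<notin> {max N 1..max N 1 + 1}"
    proof eventually_elim
      case (elim s)
      then show ?case
        using N [of s] by (auto simp: F_def)
    qed
    then have "{max N 1..max N 1 + 1} \<in> null_sets lborel"
      by (subst AE_iff_null_sets) auto
    then show False
      by (auto simp: null_sets_def)
  qed
  moreover have "(LBINT s. F s) \<ge> 0"
    using F0 by simp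
  ultimately have "0 < (LBINT s. F s)"
    by linarith
  then have "0 < - (\<Sum>i\<in>I. \<Sum>j\<in>I. c i * c j * D i j powr a) * K"
    unfolding LF .
  \<comment> \<open>Positivity of the product then excludes \<open>K = 0\<close> and fixes the sign
    of the other factor.\<close>
  moreover have "K \<ge> 0"
    unfolding K_def powr_kernel_def
    by (intro Bochner_Integration.integral_nonneg) (auto simp: indicator_def)
  ultimately show ?thesis
    by (auto simp: D_def zero_less_mult_iff mult_less_0_iff)
qed

section \<open>The spectral theorem and multidimensional scaling\<close>

text \<open>The eigenvector is a maximizer of the Rayleigh quotient.\<close>

lemma self_adjoint_eigenvector_exists:
  fixes f :: "'a::euclidean_space \<Rightarrow> 'a"
  assumes lin: "linear f" and sym: "\<And>x y. f x \<bullet> y = x \<bullet> f y"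
    and V: "subspace V" "f ` V \<subseteq> V" "x0 \<in> V" "x0 \<noteq> 0"
  obtains v m where "v \<in> V" "norm v = 1" "f v = m *\<^sub>R v"
proof -
  interpret linear f by fact
  let ?S = "V \<inter> sphere 0 1"
  have "x0 /\<^sub>R norm x0 \<in> ?S"
    using V by (auto intro: subspace_scale)
  then have "?S \<noteq> {}" by blast
  moreover have "compact ?S"
    using V(1) by (simp add: closed_Int_compact closed_subspace)
  moreover have "continuous_on ?S (\<lambda>x. f x \<bullet> x)"
    using lin by (intro continuous_intros linear_continuous_on) (simp add: linear_conv_bounded_linear)
  ultimately obtain v where v: "v \<in> ?S" and max: "\<And>x. x \<in> ?S \<Longrightarrow> f x \<bullet> x \<le> f v \<bullet> v"
    using continuous_attains_sup [of ?S "\<lambda>x. f x \<bullet> x"] by blast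
  define m where "m = f v \<bullet> v"
  have vv: "v \<bullet> v = 1" "v \<in> V"
    using v by (auto simp: norm_eq_1)
  \<comment> \<open>Homogeneity carries the maximum on the unit sphere over to all of
    \<open>V\<close>.\<close>
  have q: "f x \<bullet> x \<le> m * (x \<bullet> x)" if "x \<in> V" for x
  proof (cases "x = 0")
    case False
    have "x /\<^sub>R norm x \<in> ?S"
      using V(1) that False by (auto intro: subspace_scale)
    from max [OF this] show ?thesis
      using False by (simp add: scale m_def field_simps dot_square_norm power2_eq_square)
  qed (simp add: zero)
  define w where "w = f v - m *\<^sub>R v"
  have wV: "w \<in> V"
    unfolding w_def using V vv by (intro subspace_diff subspace_scale) auto
  \<comment> \<open>the first-order condition at the maximizer, in the direction of the residual\<close>
  have *: "2 * t * (w \<bullet> w) \<le> t\<^sup>2 * (m * (w \<bullet> w) - f w \<bullet> w)" for t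
  proof -
    have "v + t *\<^sub>R w \<in> V"
      using V(1) vv wV by (intro subspace_add subspace_scale) auto
    from q [OF this]
    have "m + 2 * t * (f v \<bullet> w) + t\<^sup>2 * (f w \<bullet> w) \<le> m * (1 + 2 * t * (v \<bullet> w) + t\<^sup>2 * (w \<bullet> w))"
      using sym [of w v]
      by (simp add: add scale inner_add inner_commute vv m_def power2_eq_square algebra_simps)
    moreover have fv: "f v \<bullet> w = w \<bullet> w + m * (v \<bullet> w)"
      by (simp add: w_def inner_diff algebra_simps)
    ultimately have "m + 2 * t * (w \<bullet> w + m * (v \<bullet> w)) + t\<^sup>2 * (f w \<bullet> w)
        \<le> m * (1 + 2 * t * (v \<bullet> w) + t\<^sup>2 * (w \<bullet> w))"
      by (simp only: fv)
    then show ?thesis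
      by (simp add: algebra_simps)
  qed
  have "w \<bullet> w = 0"
  proof (rule ccontr)
    assume nz: "w \<bullet> w \<noteq> 0"
    \<comment> \<open>A positive bound for the quadratic coefficient. With
      \<open>t = (w \<bullet> w) / b\<close> the inequality \<open>*\<close> becomes
      \<open>2 * (w \<bullet> w) \<le> w \<bullet> w\<close>.\<close>
    define b where "b = \<bar>m * (w \<bullet> w) - f w \<bullet> w\<bar> + 1"
    have pos: "w \<bullet> w > 0" "b > 0"
      using nz inner_ge_zero [of w] by (auto simp: b_def less_le)
    define t where "t = (w \<bullet> w) / b"
    have t: "t > 0" using pos by (simp add: t_def)
    have "t * (2 * (w \<bullet> w)) \<le> t * (t * (m * (w \<bullet> w) - f w \<bullet> w))"
      using * [of t] by (simp add: power2_eq_square algebra_simps)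
    then have "2 * (w \<bullet> w) \<le> t * (m * (w \<bullet> w) - f w \<bullet> w)"
      using t by simp
    also have "\<dots> \<le> t * b"
      using t by (intro mult_left_mono) (auto simp: b_def)
    also have "\<dots> = w \<bullet> w"
      using pos by (simp add: t_def)
    finally show False using pos by simp
  qed
  then have "f v = m *\<^sub>R v"
    by (simp add: w_def)
  then show thesis
    using that v by auto
qed

text \<open>An orthonormal set of eigenvectors of maximal size must span: otherwise its orthogonal
  complement, which \<open>f\<close> preserves by self-adjointness, is nonzero and contains a
  further unit eigenvector.\<close>

lemma self_adjoint_orthonormal_eigenbasis:
  fixes f :: "'a::euclidean_space \<Rightarrow> 'a"
  assumes lin: "linear f" and sym: "\<And>x y. f x \<bullet> y = x \<bullet> f y"
  obtains W where "pairwise orthogonal W" "\<And>w. w \<in> W \<Longrightarrow> norm w = 1"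
    "\<And>w. w \<in> W \<Longrightarrow> \<exists>m. f w = m *\<^sub>R w" "finite W" "card W = DIM('a)"
proof -
  interpret linear f by fact
  define P where "P W \<longleftrightarrow> pairwise orthogonal W \<and> (\<forall>w\<in>W. norm w = 1) \<and> (\<forall>w\<in>W. \<exists>m. f w = m *\<^sub>R w)" for W
  have ind: "independent W" if "P W" for W
    using that by (intro pairwise_orthogonal_independent) (auto simp: P_def)
  then have fin: "finite W \<and> card W \<le> DIM('a)" if "P W" for W
    using that independent_bound by blast
  have "P {}" by (simp add: P_def)
  moreover have "\<forall>W. P W \<longrightarrow> card W < Suc DIM('a)"
    using fin by (simp add: less_Suc_eq_le)
  ultimately obtain W where W: "P W" and max: "\<And>U. P U \<Longrightarrow> card U \<le> card W"
    using ex_has_greatest_nat [of P "{}" card "DIM('a) + 1"] by force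
  have "span W = UNIV"
  proof (rule ccontr)
    assume "span W \<noteq> UNIV"
    then obtain a where a: "a \<noteq> 0" "\<forall>x\<in>span W. a \<bullet> x = 0"
      using span_not_UNIV_orthogonal by metis
    define V where "V = {x. \<forall>w\<in>W. x \<bullet> w = 0}"
    have "subspace V"
      by (auto simp: V_def subspace_def inner_add)
    moreover have "f ` V \<subseteq> V"
      using W by (fastforce simp: V_def P_def sym)
    moreover have "a \<in> V"
      using a by (auto simp: V_def span_base)
    ultimately obtain v m where v: "v \<in> V" "norm v = 1" "f v = m *\<^sub>R v"
      using self_adjoint_eigenvector_exists [OF lin sym] a(1) by metis
    have "v \<notin> W"
      using v by (auto simp: V_def)
    moreover have "P (insert v W)"
      using W v by (auto simp: P_def V_def pairwise_insert orthogonal_def inner_commute)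
    ultimately show False
      using max [of "insert v W"] fin [OF W] by simp
  qed
  then have "card W = DIM('a)"
    using ind [OF W] by (metis dim_UNIV dim_eq_card_independent dim_span)
  then show thesis
    using that W fin [OF W] unfolding P_def by blast
qed

lemma eigendecomposition_exists:
  fixes B :: "real ^ 'p ^ 'p"
  assumes "transpose B = B"
  obtains Q l where "eigendecomposition B Q l"
proof -
  have "(B *v x) \<bullet> y = x \<bullet> (B *v y)" for x y
    by (metis assms dot_lmul_matrix transpose_matrix_vector)
  then obtain W where W: "pairwise orthogonal W" "\<And>w. w \<in> W \<Longrightarrow> norm w = 1"
    "\<And>w. w \<in> W \<Longrightarrow> \<exists>m. B *v w = m *\<^sub>R w" "finite W" "card W = CARD('p)"
    using self_adjoint_orthonormal_eigenbasis [of "(*v) B"] by (auto simp: matrix_vector_mul_linear)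
  \<comment> \<open>The eigenbasis has as many elements as the index type, so it can be indexed by
    that type and written as the columns of \<open>Q\<close>.\<close>
  obtain b where b: "bij_betw b (UNIV :: 'p set) W"
    using finite_same_card_bij [of "UNIV :: 'p set" W] W by auto
  define Q :: "real ^ 'p ^ 'p" where "Q = (\<chi> i j. b j $ i)"
  have col: "column j Q = b j" for j
    by (simp add: column_def Q_def vec_eq_iff)
  have bW: "b j \<in> W" for j
    using b by (auto simp: bij_betw_def)
  have inj: "i \<noteq> j \<Longrightarrow> b i \<noteq> b j" for i j
    using b by (auto simp: bij_betw_def inj_def)
  have oQ: "orthogonal_matrix Q"
    unfolding orthogonal_matrix_orthonormal_columns col using W bW inj by (auto simp: pairwise_def)
  have "\<forall>j. \<exists>m. B *v b j = m *\<^sub>R b j"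
    using W(3) bW by blast
  then obtain m where m: "\<And>j. B *v b j = m j *\<^sub>R b j"
    using choice [of "\<lambda>j m. B *v b j = m *\<^sub>R b j"] by blast
  have "B ** Q = Q ** diag_mat (\<chi> j. m j)"
  proof -
    have "(B ** Q) $ i $ j = (B *v b j) $ i" for i j
      by (simp add: matrix_matrix_mult_def matrix_vector_mult_def Q_def)
    then show ?thesis
      by (simp add: vec_eq_iff diag_mat_mult_right m) (simp add: Q_def)
  qed
  then have "B = Q ** diag_mat (\<chi> j. m j) ** transpose Q"
    using oQ by (metis matrix_mul_assoc matrix_mul_rid orthogonal_matrix_def)
  then show thesis
    using that oQ by (auto simp: eigendecomposition_def)
qed

section \<open>Squared distance matrices and double centering\<close>

lemma gram_to_sqdist_component:
  "gram_to_sqdist G $ i $ j = G $ i $ i + G $ j $ j - 2 * G $ i $ j"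
  by (simp add: gram_to_sqdist_def outer_def diag_vec_def)

text \<open>In this form each entry is monotone in every eigenvalue, so clipping negative
  eigenvalues can only increase it.\<close>

lemma gram_to_sqdist_diagonalized:
  "gram_to_sqdist (Q ** diag_mat l ** transpose Q) $ i $ j = (\<Sum>k\<in>UNIV. l $ k * (Q $ i $ k - Q $ j $ k)\<^sup>2)"
proof -
  have "(Q ** diag_mat l ** transpose Q) $ i $ j = (\<Sum>k\<in>UNIV. Q $ i $ k * l $ k * Q $ j $ k)" for i j
    unfolding matrix_matrix_mult_def [of "Q ** _"] by (simp add: diag_mat_mult_right transpose_def)
  then show ?thesis
    by (simp add: gram_to_sqdist_component power2_eq_square algebra_simps sum.distrib
        sum_subtractf sum_distrib_left)
qed

lemma transpose_centering: "transpose centering = centering"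
  by (simp add: centering_def transpose_def mat_def outer_def vec_eq_iff)

lemma centering_mult:
  fixes Y :: "real ^ 'n ^ 'p"
  shows "(centering ** Y) $ i $ j = Y $ i $ j - (\<Sum>k\<in>UNIV. Y $ k $ j) / CARD('p)"
  by (simp add: centering_def matrix_matrix_mult_def mat_def outer_def left_diff_distrib
      sum_subtractf if_distrib [of "\<lambda>x. x * _"] sum_divide_distrib cong: if_cong)

lemma mult_centering:
  fixes Y :: "real ^ 'p ^ 'n"
  shows "(Y ** centering) $ i $ j = Y $ i $ j - (\<Sum>k\<in>UNIV. Y $ i $ k) / CARD('p)"
  by (simp add: centering_def matrix_matrix_mult_def mat_def outer_def right_diff_distrib
      sum_subtractf if_distrib [of "\<lambda>x. _ * x"] sum_divide_distrib cong: if_cong)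

lemma transpose_double_centering:
  fixes Y :: "real ^ 'p ^ 'p"
  shows "transpose (c *\<^sub>R (centering ** Y ** centering)) = c *\<^sub>R (centering ** transpose Y ** centering)"
  by (simp only: transpose_scalar matrix_transpose_mul transpose_centering matrix_mul_assoc)

lemma transpose_eq_component:
  assumes "transpose Y = Y"
  shows "Y $ i $ j = Y $ j $ i"
proof -
  have "transpose Y $ i $ j = Y $ j $ i"
    by (simp add: transpose_def)
  then show ?thesis
    by (simp only: assms)
qed

lemma gram_to_sqdist_double_centering:
  fixes Y :: "real ^ 'p ^ 'p"
  assumes sym: "transpose Y = Y" and diag: "\<And>i. Y $ i $ i = 0"
  shows "gram_to_sqdist (- (1 / 2) *\<^sub>R (centering ** Y ** centering)) = Y"
proof -
  \<comment> \<open>Row means \<open>r\<close> and grand mean \<open>m\<close>: double centering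
    gives \<open>Y $ i $ j - r i - r j + m\<close>, and passing back to squared distances cancels
    all means since \<open>Y\<close> has zero diagonal.\<close>
  define r where "r i = (\<Sum>k\<in>UNIV. Y $ i $ k) / CARD('p)" for i
  define m where "m = (\<Sum>k\<in>UNIV. r k) / CARD('p)"
  have "(\<Sum>k\<in>UNIV. Y $ k $ i) / CARD('p) = r i" for i
    unfolding r_def by (intro arg_cong2 [of _ _ _ _ "(/)"] sum.cong refl transpose_eq_component sym)
  then have "(centering ** Y) $ i $ j = Y $ i $ j - r j" for i j
    by (simp add: centering_mult)
  then have "(centering ** Y ** centering) $ i $ j = Y $ i $ j - r j - (r i - m)" for i j
    by (simp add: mult_centering sum_subtractf diff_divide_distrib r_def [of i] m_def)
  then show ?thesis
    by (simp add: vec_eq_iff gram_to_sqdist_component diag) (simp add: field_simps)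
qed

lemma MDS_plus_sqdist:
  fixes Y :: "real ^ 'p ^ 'p"
  assumes sym: "transpose Y = Y" and diag: "\<And>i. Y $ i $ i = 0"
  obtains x :: "'p \<Rightarrow> real ^ 'p" where
    "\<And>i j. MDS_plus Y $ i $ j = (dist (x i) (x j))\<^sup>2" "\<And>i j. Y $ i $ j \<le> MDS_plus Y $ i $ j"
proof -
  let ?B = "- (1 / 2) *\<^sub>R (centering ** Y ** centering)"
  have "transpose ?B = ?B"
    by (simp only: transpose_double_centering sym)
  then obtain Q l where E: "eigendecomposition ?B Q l"
    by (rule eigendecomposition_exists)
  define D where "D = gram_to_sqdist (Q ** diag_mat (\<chi> i. max 0 (l $ i)) ** transpose Q)"
  have "is_MDS_plus Y D"
    unfolding is_MDS_plus_def D_def using E by blast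
  then have M: "MDS_plus Y = D"
    unfolding MDS_plus_def using is_MDS_plus_unique by blast
  have D: "D $ i $ j = (\<Sum>k\<in>UNIV. max 0 (l $ k) * (Q $ i $ k - Q $ j $ k)\<^sup>2)" for i j
    by (simp add: D_def gram_to_sqdist_diagonalized)
  have "gram_to_sqdist (Q ** diag_mat l ** transpose Q) = Y"
    using gram_to_sqdist_double_centering [OF assms] E by (simp only: eigendecomposition_def)
  then have Y: "Y $ i $ j = (\<Sum>k\<in>UNIV. l $ k * (Q $ i $ k - Q $ j $ k)\<^sup>2)" for i j
    by (simp only: flip: gram_to_sqdist_diagonalized)
  \<comment> \<open>The classical embedding: rows of \<open>Q\<close> with coordinates scaled by the
    square roots of the clipped eigenvalues.\<close>
  define x :: "'p \<Rightarrow> real ^ 'p" where "x i = (\<chi> k. sqrt (max 0 (l $ k)) * Q $ i $ k)" for i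
  have "(dist (x i) (x j))\<^sup>2 = D $ i $ j" for i j
    unfolding D dist_norm power2_norm_eq_inner inner_vec_def
    by (intro sum.cong refl)
       (simp add: x_def power_mult_distrib flip: right_diff_distrib power2_eq_square)
  moreover have "Y $ i $ j \<le> D $ i $ j" for i j
    unfolding Y D by (intro sum_mono mult_right_mono) auto
  ultimately show thesis
    using that [of x] M by simp
qed

section \<open>Inverting a matrix with kernel spanned by the all-ones vector\<close>

text \<open>The orthogonal projection onto the span of the all-ones vector. As an input abbreviation
  it is literally the term that occurs in \<open>centering\<close> and in the theorem.\<close>

abbreviation (input) mean_proj :: "real ^ 'p ^ 'p" where
  "mean_proj \<equiv> (1 / real CARD('p)) *\<^sub>R outer 1 1"

lemma transpose_mean_proj: "transpose (mean_proj :: real ^ 'p ^ 'p) = mean_proj"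
  by (simp add: transpose_def outer_def vec_eq_iff)

lemma mean_proj_mult_vec:
  fixes x :: "real ^ 'p"
  shows "mean_proj *v x = ((1 \<bullet> x) / CARD('p)) *\<^sub>R 1"
  by (simp add: outer_def vec_eq_iff matrix_vector_mult_def inner_vec_def sum_divide_distrib)

lemma inner_one_one: "(1 :: real ^ 'p) \<bullet> 1 = CARD('p)"
  by (simp add: inner_vec_def)

lemma mean_proj_idem: "mean_proj ** mean_proj = (mean_proj :: real ^ 'p ^ 'p)"
  by (simp add: outer_def vec_eq_iff matrix_matrix_mult_def)

lemma mult_mean_proj_eq_0:
  fixes A :: "real ^ 'p ^ 'p"
  assumes "transpose A = A" "A *v 1 = 0"
  shows "A ** mean_proj = 0" "mean_proj ** A = 0"
proof -
  show 1: "A ** mean_proj = 0"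
    using assms(2) by (simp add: vec_eq_iff matrix_matrix_mult_def matrix_vector_mult_def outer_def
        flip: sum_divide_distrib)
  show "mean_proj ** A = 0"
    using arg_cong [OF 1, of transpose] assms(1)
    by (simp add: matrix_transpose_mul transpose_mean_proj) (simp add: transpose_def vec_eq_iff)
qed

lemma matrix_add_rdistrib: "(A + B) ** C = A ** C + B ** (C :: real ^ 'n ^ 'm)"
  by (simp add: vec_eq_iff matrix_matrix_mult_def distrib_right sum.distrib)

lemma matrix_diff_rdistrib: "(A - B) ** C = A ** C - B ** (C :: real ^ 'n ^ 'm)"
  by (simp add: vec_eq_iff matrix_matrix_mult_def left_diff_distrib sum_subtractf)

lemma invertible_mult_matrix_inv:
  fixes M :: "real ^ 'n ^ 'n"
  assumes "invertible M"
  shows "M ** matrix_inv M = mat 1" "matrix_inv M ** M = mat 1"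
  using assms someI_ex [of "\<lambda>N. M ** N = mat 1 \<and> N ** M = mat 1"]
  unfolding invertible_def matrix_inv_def by auto

text \<open>\<open>A + mean_proj\<close> is the identity on the span of the all-ones vector and acts
  as \<open>A\<close> on its complement. Its inverse splits in the same way, and subtracting
  \<open>mean_proj\<close> leaves the inverse of \<open>A\<close> on the complement, extended by
  zero.\<close>

lemma laplacian_of_positive_definite_complement:
  fixes A L :: "real ^ 'p ^ 'p"
  assumes sym: "transpose A = A" and A1: "A *v 1 = 0"
    and pos: "\<And>x. x \<noteq> 0 \<Longrightarrow> 1 \<bullet> x = 0 \<Longrightarrow> 0 < x \<bullet> (A *v x)"
    and L: "L = matrix_inv (A + mean_proj) - mean_proj"
  shows "invertible (A + mean_proj) \<and> signed_laplacian L \<and> positive_semidefinite L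
    \<and> rank L = CARD('p) - 1 \<and> L = pseudoinverse A"
proof -
  let ?E = "mean_proj :: real ^ 'p ^ 'p"
  define M where "M = A + ?E"
  define N where "N = matrix_inv M"
  have AE: "A ** ?E = 0" "?E ** A = 0"
    using mult_mean_proj_eq_0 [OF sym A1] by auto
  have M1: "M *v 1 = 1"
    by (simp add: M_def matrix_vector_mult_add_rdistrib A1 mean_proj_mult_vec inner_one_one)
  have tM: "transpose M = M"
    using sym transpose_mean_proj by (simp add: M_def transpose_def vec_eq_iff)
  have sA: "x \<bullet> (A *v y) = (A *v x) \<bullet> y" for x y
    by (metis sym dot_lmul_matrix transpose_matrix_vector)
  have A0: "0 \<le> x \<bullet> (A *v x)" for x
  proof -
    \<comment> \<open>The component of \<open>x\<close> orthogonal to the kernel vector; the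
      quadratic form of \<open>A\<close> sees only this part.\<close>
    define y where "y = x - ((1 \<bullet> x) / CARD('p)) *\<^sub>R 1"
    have Ay: "A *v y = A *v x"
      by (simp add: y_def matrix_vector_mult_diff_distrib A1 matrix_vector_mult_scaleR)
    have "1 \<bullet> y = 0"
      by (simp add: y_def inner_diff inner_one_one)
    then have "0 \<le> y \<bullet> (A *v y)"
      using pos [of y] by (cases "y = 0") auto
    also have "\<dots> = x \<bullet> (A *v x)"
      by (metis Ay sA)
    finally show ?thesis .
  qed
  have "M *v x = 0 \<Longrightarrow> x = 0" for x
  proof -
    assume "M *v x = 0"
    \<comment> \<open>\<open>M\<close> is symmetric and fixes the all-ones vector, so a kernel
      vector of \<open>M\<close> lies in the complement, where \<open>A\<close> is definite.\<close>
    moreover have s: "1 \<bullet> (M *v x) = 1 \<bullet> x"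
      by (metis M1 tM dot_lmul_matrix transpose_matrix_vector)
    ultimately have "1 \<bullet> x = 0" by simp
    moreover from this have "A *v x = 0"
      using \<open>M *v x = 0\<close> by (simp add: M_def matrix_vector_mult_add_rdistrib mean_proj_mult_vec)
    ultimately show "x = 0"
      using pos [of x] by auto
  qed
  then have inv: "invertible M"
    by (simp add: invertible_left_inverse matrix_left_invertible_ker)
  note MN = invertible_mult_matrix_inv [OF inv, folded N_def]
  have tN: "transpose N = N"
    by (metis MN tM matrix_mul_assoc matrix_mul_lid matrix_mul_rid matrix_transpose_mul transpose_mat)
  have ME: "M ** ?E = ?E" "?E ** M = ?E"
    unfolding M_def matrix_add_ldistrib matrix_add_rdistrib AE mean_proj_idem by simp_all
  have NE: "N ** ?E = ?E" "?E ** N = ?E"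
    by (metis MN ME matrix_mul_assoc matrix_mul_lid matrix_mul_rid)+
  have LN: "L = N - ?E"
    by (simp add: L N_def M_def)
  have tL: "transpose L = L"
    using tN transpose_mean_proj by (simp add: LN transpose_def vec_eq_iff)
  have L1: "L *v 1 = 0"
  proof -
    have "N *v 1 = 1"
      by (metis M1 MN(2) matrix_vector_mul_assoc matrix_vector_mul_lid)
    then show ?thesis
      by (simp add: LN matrix_vector_mult_diff_rdistrib mean_proj_mult_vec inner_one_one)
  qed
  have LE: "L ** ?E = 0" "?E ** L = 0"
    using mult_mean_proj_eq_0 [OF tL L1] by auto
  have "M ** N = (A + ?E) ** (L + ?E)" "N ** M = (L + ?E) ** (A + ?E)"
    by (simp_all add: M_def LN)
  \<comment> \<open>The cross terms with \<open>?E\<close> vanish, so \<open>M ** N = mat 1\<close>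
    reads \<open>A ** L + ?E = mat 1\<close>. Both products are thus the symmetric centering
    projection, which yields the Penrose equations.\<close>
  then have AL: "A ** L = mat 1 - ?E" and LA: "L ** A = mat 1 - ?E"
    unfolding matrix_add_ldistrib matrix_add_rdistrib AE LE mean_proj_idem MN
    by (simp_all add: algebra_simps)
  have tJ: "transpose (mat 1 - ?E) = mat 1 - ?E"
    using transpose_centering by (simp add: centering_def)
  have ALA: "A ** L ** A = A"
    unfolding AL by (simp add: matrix_diff_rdistrib AE)
  have LAL: "L ** A ** L = L"
    unfolding LA by (simp add: matrix_diff_rdistrib LE)
  have "is_pseudoinverse A L"
    unfolding is_pseudoinverse_def ALA LAL unfolding AL LA tJ by simp
  then have pinv: "L = pseudoinverse A"
    unfolding pseudoinverse_def using is_pseudoinverse_unique by (metis the_equality)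
  have "0 \<le> x \<bullet> (L *v x)" for x
  proof -
    \<comment> \<open>Writing \<open>L\<close> as \<open>L ** A ** L\<close> turns its form at
      \<open>x\<close> into the form of \<open>A\<close> at \<open>L *v x\<close>.\<close>
    have "x \<bullet> (L *v x) = x \<bullet> (L *v (A *v (L *v x)))"
      by (simp add: matrix_vector_mul_assoc matrix_mul_assoc LAL)
    also have "\<dots> = (L *v x) \<bullet> (A *v (L *v x))"
      by (metis tL dot_lmul_matrix transpose_matrix_vector)
    finally show ?thesis
      using A0 by simp
  qed
  then have psd: "positive_semidefinite L"
    using tL by (simp add: positive_semidefinite_def)
  \<comment> \<open>The rank is the dimension of this hyperplane; \<open>L ** A\<close> acts as the
    identity on it, so all of it is attained.\<close>
  have "range ((*v) L) = {y. 1 \<bullet> y = 0}"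
  proof (intro equalityI subsetI)
    fix y assume "y \<in> range ((*v) L)"
    then show "y \<in> {y. 1 \<bullet> y = 0}"
      using tL L1 by (auto, metis dot_lmul_matrix inner_zero_left transpose_matrix_vector)
  next
    fix y :: "real ^ 'p" assume "y \<in> {y. 1 \<bullet> y = 0}"
    then have "y = (mat 1 - ?E) *v y"
      by (simp add: matrix_vector_mult_diff_rdistrib mean_proj_mult_vec)
    also have "\<dots> = L *v (A *v y)"
      by (simp add: LA matrix_vector_mul_assoc)
    finally show "y \<in> range ((*v) L)" by blast
  qed
  then have "rank L = CARD('p) - 1"
    by (simp add: rank_dim_range dim_hyperplane vec_eq_iff)
  then show ?thesis
    using inv psd pinv tL L1 by (simp add: M_def signed_laplacian_def)
qed

section \<open>Application to the covariance and the double-centered power\<close>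

lemma quadratic_form_eq_sum:
  fixes A :: "real ^ 'p ^ 'p"
  shows "x \<bullet> (A *v x) = (\<Sum>i\<in>UNIV. \<Sum>j\<in>UNIV. x $ i * x $ j * A $ i $ j)"
  by (simp add: inner_vec_def matrix_vector_mult_def sum_distrib_left mult_ac)

lemma centering_mult_vec:
  "centering *v x = x - ((1 \<bullet> x) / CARD('p)) *\<^sub>R (1 :: real ^ 'p)"
  by (simp add: centering_def matrix_vector_mult_diff_rdistrib mean_proj_mult_vec)

lemma gram_to_sqdist_covariance:
  fixes X :: "real ^ 'p ^ 'n"
  shows "gram_to_sqdist ((1 / real CARD('n)) *\<^sub>R (\<Sum>i\<in>UNIV. outer (row i X) (row i X))) $ i $ j
    = (dist (column i X) (column j X))\<^sup>2 / CARD('n)"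
proof -
  have "(\<Sum>k\<in>UNIV. outer (row k X) (row k X)) $ i $ j = column i X \<bullet> column j X" for i j
    by (simp add: outer_def row_def column_def inner_vec_def)
  then show ?thesis
    by (simp add: gram_to_sqdist_component dist_norm power2_norm_eq_inner inner_diff
        inner_commute diff_divide_distrib add_divide_distrib)
qed

text \<open>Centering fixes \<open>v\<close>, so the double-centered form at \<open>v\<close> equals
  that of \<open>R\<close>, which is negative because the entries of \<open>v\<close> sum to zero;
  the factor \<open>- (1 / 2)\<close> reverses the sign.\<close>

lemma double_centered_sqdist_powr_pos:
  fixes x :: "'p::finite \<Rightarrow> 'a::euclidean_space" and v :: "real ^ 'p"
  assumes "inj x" "0 < a" "a < 1" "v \<noteq> 0" "1 \<bullet> v = 0"
    and R: "\<And>i j. R $ i $ j = ((dist (x i) (x j))\<^sup>2) powr a"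
  shows "0 < v \<bullet> ((- (1 / 2) *\<^sub>R (centering ** R ** centering)) *v v)"
proof -
  have cv: "centering *v v = v"
    using assms by (simp add: centering_mult_vec)
  have "v \<bullet> ((centering ** R ** centering) *v v) = v \<bullet> (centering *v (R *v v))"
    by (simp add: cv flip: matrix_vector_mul_assoc)
  also have "\<dots> = v \<bullet> (R *v v)"
    by (metis cv transpose_centering dot_lmul_matrix transpose_matrix_vector)
  also have "\<dots> < 0"
    unfolding quadratic_form_eq_sum R
    using assms by (intro sqdist_powr_conditionally_negative) (auto simp: vec_eq_iff inner_vec_def)
  finally show ?thesis
    by (simp only: scaleR_matrix_vector_assoc [symmetric] inner_scaleR_right)
qed

theorem proposition4:
  fixes X :: "real ^ 'p ^ 'n" and \<gamma> :: real
    and S Rhat Rbar Lbar :: "real ^ 'p ^ 'p"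
  assumes distinct_columns: "\<forall>j k. j \<noteq> k \<longrightarrow> column j X \<noteq> column k X"
    and gamma: "\<gamma> > 1"
    and S: "S = (1 / real CARD('n)) *\<^sub>R (\<Sum>i\<in>UNIV. outer (row i X) (row i X))"
    and Rhat: "Rhat = outer 1 (diag_vec S) + outer (diag_vec S) 1 - 2 *\<^sub>R S"
    and Rbar: "Rbar = hadamard_power (MDS_plus (hadamard_power Rhat \<gamma>)) (1 / \<gamma>)"
    and Lbar: "Lbar = matrix_inv (- (1 / 2) *\<^sub>R (centering ** Rbar ** centering)
                          + (1 / real CARD('p)) *\<^sub>R outer 1 1)
                      - (1 / real CARD('p)) *\<^sub>R outer 1 1"
  shows "invertible (- (1 / 2) *\<^sub>R (centering ** Rbar ** centering)
                          + (1 / real CARD('p)) *\<^sub>R outer 1 (1 :: real ^ 'p))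
    \<and> signed_laplacian Lbar \<and> positive_semidefinite Lbar \<and> rank Lbar = CARD('p) - 1
    \<and> Lbar = pseudoinverse (- (1 / 2) *\<^sub>R (centering ** Rbar ** centering))"
proof -
  let ?Y = "hadamard_power Rhat \<gamma>"
  let ?A = "- (1 / 2) *\<^sub>R (centering ** Rbar ** centering)"
  have Rhat_eq: "Rhat $ i $ j = (dist (column i X) (column j X))\<^sup>2 / CARD('n)" for i j
    using gram_to_sqdist_covariance [of X i j] by (simp add: Rhat gram_to_sqdist_def flip: S)
  have Y: "?Y $ i $ j = ((dist (column i X) (column j X))\<^sup>2 / CARD('n)) powr \<gamma>" for i j
    by (simp add: hadamard_power_def Rhat_eq)
  have "transpose ?Y = ?Y"
    by (simp add: vec_eq_iff transpose_def Y dist_commute)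
  \<comment> \<open>Here the convention \<open>0 powr \<gamma> = 0\<close> enters.\<close>
  moreover have "?Y $ i $ i = 0" for i
    by (simp add: Y)
  ultimately obtain x :: "'p \<Rightarrow> real ^ 'p" where
    D: "\<And>i j. MDS_plus ?Y $ i $ j = (dist (x i) (x j))\<^sup>2" and
    le: "\<And>i j. ?Y $ i $ j \<le> MDS_plus ?Y $ i $ j"
    using MDS_plus_sqdist by metis
  have "x i \<noteq> x j" if "i \<noteq> j" for i j
  proof -
    \<comment> \<open>Distinct columns make the off-diagonal input positive, and domination passes
      this on to the embedded points.\<close>
    have "0 < ?Y $ i $ j"
      using distinct_columns that by (simp add: Y)
    with le [of i j] show ?thesis
      by (auto simp: D)
  qed
  then have inj: "inj x"
    by (meson injI)
  have Rb: "Rbar $ i $ j = ((dist (x i) (x j))\<^sup>2) powr (1 / \<gamma>)" for i j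
    unfolding Rbar hadamard_power_def [of "MDS_plus ?Y"] by (simp add: D)
  have tR: "transpose Rbar = Rbar"
    by (simp add: vec_eq_iff transpose_def Rb dist_commute)
  have "transpose ?A = ?A"
    by (simp only: transpose_double_centering tR)
  moreover have "?A *v 1 = 0"
    unfolding scaleR_matrix_vector_assoc [symmetric]
    by (simp add: centering_mult_vec inner_one_one flip: matrix_vector_mul_assoc)
  \<comment> \<open>From \<open>\<gamma> > 1\<close> the exponent \<open>1 / \<gamma>\<close> lies
    strictly between 0 and 1.\<close>
  moreover have "0 < v \<bullet> (?A *v v)" if "v \<noteq> 0" "1 \<bullet> v = 0" for v
    using gamma that by (intro double_centered_sqdist_powr_pos [OF inj _ _ _ _ Rb]) auto
  ultimately show ?thesis
    using Lbar by (rule laplacian_of_positive_definite_complement)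
qed

end
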